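(* Let $(S,\to,\twoheadrightarrow,\hookrightarrow)$ be a two-acyclic factorization system and let $X\subseteq S$ be a closed set. Let $C(X)$ be the set of $\hookrightarrow$-maximal elements of $X$. Then every element of $\operatorname{Cov}(X)$ is a $\twoheadrightarrow$-maximal element of $C(X)$. If $S$ is finite, or more generally if $X$ is finite, then $\operatorname{Cov}(X)$ is precisely the set of $\twoheadrightarrow$-maximal elements of $C(X)$.
   Context: For a binary relation $\to$ on a set $S$ and $X\subseteq S$, put $X^\perp=\{y\in S: x\not\to y\ \forall x\in X\}$ and ${}^\perp X=\{y\in S: y\not\to x\ \forall x\in X\}$. The closure of $X$ is $\overline X={}^\perp(X^\perp)$; $X$ is closed if $\overline X=X$. For a reflexive relation $\to$ on $S$, $\operatorname{Fact}(\to)=(\twoheadrightarrow,\hookrightarrow)$, where $x\twoheadrightarrow y$ iff for all $z$, $y\to z$ implies $x\to z$, and $x\hookrightarrow y$ iff for all $z$, $z\to x$ implies $z\to y$. For preorders $\twoheadrightarrow,\hookrightarrow$ on $S$, $\operatorname{Mult}(\twoheadrightarrow,\hookrightarrow)$ is the relation relating $x$ to $z$ iff there is $y\in S$ with $x\twoheadrightarrow y\hookrightarrow z$. A factorization system is a tuple $(S,\to,\twoheadrightarrow,\hookrightarrow)$ ($S$ possibly infinite) with $\to$ reflexive, $\operatorname{Fact}(\to)=(\twoheadrightarrow,\hookrightarrow)$ and $\operatorname{Mult}(\twoheadrightarrow,\hookrightarrow)=\to$. It is two-acyclic if $x\twoheadrightarrow y\twoheadrightarrow x$ implies $x=y$,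 $x\hookrightarrow y\hookrightarrow x$ implies $x=y$, and $x\twoheadrightarrow y\hookrightarrow x$ implies $x=y$. For $c\in X$, $\operatorname{Del}(X,c)=X\setminus\{x\in X: x\twoheadrightarrow c\}$. For a closed set $X$, $\operatorname{Cov}(X)$ is the set of elements $c\in X$ such that $\operatorname{Del}(X,c)$ is closed and $\overline{\operatorname{Del}(X,c)\cup\{c\}}=X$. Convention: $x\twoheadrightarrow y$ (resp. $x\hookrightarrow y$) is read as "$x$ is greater than or equal to $y$". Thus $c$ is a $\hookrightarrow$-maximal (resp. $\twoheadrightarrow$-maximal) element of a set $A\ni c$ if there is no $c'\in A\setminus\{c\}$ with $c'\hookrightarrow c$ (resp. $c'\twoheadrightarrow c$). *)

theory Defs
  imports Main
begin

text \<open>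
  A relation on a set \<open>S\<close> is a set of pairs contained in \<open>S \<times> S\<close>, where \<open>S\<close> is an explicit, possibly
  infinite carrier. Throughout, \<open>r\<close> is the relation \<open>\<rightarrow>\<close>, \<open>e\<close> is \<open>\<twoheadrightarrow>\<close> and \<open>m\<close> is \<open>\<hookrightarrow>\<close>.
\<close>

definition right_perp :: "'a set \<Rightarrow> 'a rel \<Rightarrow> 'a set \<Rightarrow> 'a set" where
  "right_perp S r X = {y \<in> S. \<forall>x\<in>X. (x, y) \<notin> r}"

definition left_perp :: "'a set \<Rightarrow> 'a rel \<Rightarrow> 'a set \<Rightarrow> 'a set" where
  "left_perp S r X = {y \<in> S. \<forall>x\<in>X. (y, x) \<notin> r}"

definition perp_closure :: "'a set \<Rightarrow> 'a rel \<Rightarrow> 'a set \<Rightarrow> 'a set" where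
  "perp_closure S r X = left_perp S r (right_perp S r X)"

definition perp_closed :: "'a set \<Rightarrow> 'a rel \<Rightarrow> 'a set \<Rightarrow> bool" where
  "perp_closed S r X \<longleftrightarrow> X \<subseteq> S \<and> perp_closure S r X = X"

definition Fact :: "'a set \<Rightarrow> 'a rel \<Rightarrow> 'a rel \<times> 'a rel" where
  "Fact S r =
    ({(x, y). x \<in> S \<and> y \<in> S \<and> (\<forall>z\<in>S. (y, z) \<in> r \<longrightarrow> (x, z) \<in> r)},
     {(x, y). x \<in> S \<and> y \<in> S \<and> (\<forall>z\<in>S. (z, x) \<in> r \<longrightarrow> (z, y) \<in> r)})"

definition Mult :: "'a set \<Rightarrow> 'a rel \<times> 'a rel \<Rightarrow> 'a rel" where
  "Mult S = (\<lambda>(e, m). {(x, z). x \<in> S \<and> z \<in> S \<and> (\<exists>y\<in>S. (x, y) \<in> e \<and> (y, z) \<in> m)})"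

text \<open>\<^const>\<open>refl_on\<close> does not bound the relation by its carrier, hence the separate inclusion.\<close>

definition factorization_system :: "'a set \<Rightarrow> 'a rel \<Rightarrow> 'a rel \<Rightarrow> 'a rel \<Rightarrow> bool" where
  "factorization_system S r e m \<longleftrightarrow>
    r \<subseteq> S \<times> S \<and> refl_on S r \<and> Fact S r = (e, m) \<and> Mult S (e, m) = r"

definition two_acyclic :: "'a rel \<Rightarrow> 'a rel \<Rightarrow> bool" where
  "two_acyclic e m \<longleftrightarrow>
    antisym e \<and> antisym m \<and> (\<forall>x y. (x, y) \<in> e \<and> (y, x) \<in> m \<longrightarrow> x = y)"

definition Del :: "'a rel \<Rightarrow> 'a set \<Rightarrow> 'a \<Rightarrow> 'a set" where
  "Del e X c = X - {x \<in> X. (x, c) \<in> e}"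

definition Cov :: "'a set \<Rightarrow> 'a rel \<Rightarrow> 'a rel \<Rightarrow> 'a set \<Rightarrow> 'a set" where
  "Cov S r e X =
    {c \<in> X. perp_closed S r (Del e X c) \<and> perp_closure S r (Del e X c \<union> {c}) = X}"

text \<open>A pair \<open>(x, y)\<close> in \<open>q\<close> is read as: \<open>x\<close> is greater than or equal to \<open>y\<close>.\<close>

definition maximal_elements :: "'a rel \<Rightarrow> 'a set \<Rightarrow> 'a set" where
  "maximal_elements q A = {c \<in> A. \<not> (\<exists>c' \<in> A - {c}. (c', c) \<in> q)}"

end

theory Submission
  imports Defs
begin

text \<open>
  If \<open>d \<rightarrow> c\<close> with \<open>c\<close> a \<open>\<hookrightarrow>\<close>-maximal element of the closed set \<open>X\<close> and \<open>d \<in> X\<close>, then factoring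
  \<open>d \<twoheadrightarrow> y \<hookrightarrow> c\<close> gives \<open>y \<in> X\<close>, so \<open>y = c\<close> and \<open>d \<twoheadrightarrow> c\<close>. Thus the relation \<open>c \<rightarrow> c\<close> alone certifies that
  \<open>c\<close> is not in the closure of \<open>Del(X, c)\<close>. Conversely, testing membership in \<open>X\<close> on the
  relations \<open>c' \<rightarrow> c'\<close> excludes any \<open>c'\<close> strictly above \<open>c\<close>. Finiteness is used only to find,
  above a given element of \<open>X\<close>, a \<open>\<hookrightarrow>\<close>-maximal one.
\<close>

text \<open>The two orthogonality conditions cancel by contraposition, so membership becomes a test
  on each relation leaving \<open>x\<close>.\<close>

lemma mem_perp_closure_iff:
  "x \<in> perp_closure S r X \<longleftrightarrow>
    x \<in> S \<and> (\<forall>z\<in>S. (x, z) \<in> r \<longrightarrow> (\<exists>d\<in>X. (d, z) \<in> r))"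
  unfolding perp_closure_def left_perp_def right_perp_def by blast

lemma perp_closure_mono: "X \<subseteq> Y \<Longrightarrow> perp_closure S r X \<subseteq> perp_closure S r Y"
  unfolding subset_iff mem_perp_closure_iff by blast

lemma subset_perp_closure: "X \<subseteq> S \<Longrightarrow> X \<subseteq> perp_closure S r X"
  by (auto simp: mem_perp_closure_iff)

lemma perp_closed_subset: "perp_closed S r X \<Longrightarrow> X \<subseteq> S"
  by (simp add: perp_closed_def)

lemma perp_closure_eq: "perp_closed S r X \<Longrightarrow> perp_closure S r X = X"
  by (simp add: perp_closed_def)

lemma finite_maximal_above:
  assumes "finite X" "trans q" "antisym q" "x \<in> X" "(x, x) \<in> q"
  obtains c where "c \<in> maximal_elements q X" "(c, x) \<in> q"
proof -
  let ?A = "{y \<in> X. (y, x) \<in> q}"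
  \<comment> \<open>In \<open>q\<close> the larger element stands on the left, so the strict order
    is flipped before a maximum is taken.\<close>
  have "asymp_on ?A (\<lambda>y z. (z, y) \<in> q \<and> z \<noteq> y)"
    using \<open>antisym q\<close> by (auto simp: asymp_on_def antisym_def)
  moreover have "transp_on ?A (\<lambda>y z. (z, y) \<in> q \<and> z \<noteq> y)"
    using \<open>antisym q\<close> \<open>trans q\<close> unfolding transp_on_def antisym_def trans_def by blast
  moreover have "finite ?A" "?A \<noteq> {}"
    using assms by auto
  ultimately obtain c where "c \<in> ?A" "\<And>y. y \<in> ?A \<Longrightarrow> \<not> ((y, c) \<in> q \<and> y \<noteq> c)"
    using Finite_Set.bex_max_element[of ?A "\<lambda>y z. (z, y) \<in> q \<and> z \<noteq> y"] by blast
  \<comment> \<open>Anything above \<open>c\<close> is also above \<open>x\<close>, hence already in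
    \<open>?A\<close>.\<close>
  then have "c \<in> maximal_elements q X" "(c, x) \<in> q"
    using \<open>trans q\<close> unfolding maximal_elements_def trans_def by blast+
  then show thesis by (rule that)
qed

context
  fixes S X :: "'a set" and r e m :: "'a rel"
  assumes fs: "factorization_system S r e m"
    and X: "perp_closed S r X"
begin

lemma e_iff: "(x, y) \<in> e \<longleftrightarrow> x \<in> S \<and> y \<in> S \<and> (\<forall>z\<in>S. (y, z) \<in> r \<longrightarrow> (x, z) \<in> r)"
  using fs unfolding factorization_system_def Fact_def by auto

lemma m_iff: "(x, y) \<in> m \<longleftrightarrow> x \<in> S \<and> y \<in> S \<and> (\<forall>z\<in>S. (z, x) \<in> r \<longrightarrow> (z, y) \<in> r)"
  using fs unfolding factorization_system_def Fact_def by auto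

lemma r_refl: "x \<in> S \<Longrightarrow> (x, x) \<in> r"
  using fs unfolding factorization_system_def by (auto dest: refl_onD)

lemma trans_e: "trans e" and trans_m: "trans m"
  unfolding trans_def e_iff m_iff by blast+

lemma m_imp_r: "(x, y) \<in> m \<Longrightarrow> (x, y) \<in> r"
  using m_iff r_refl by blast

lemma r_m_trans: "(x, y) \<in> r \<Longrightarrow> (y, z) \<in> m \<Longrightarrow> (x, z) \<in> r"
  using fs m_iff unfolding factorization_system_def by blast

text \<open>Every relation leaving \<open>y\<close> also leaves \<open>x\<close>, so
  \<open>y\<close> has no new test to pass.\<close>

lemma perp_closure_e_down:
  "x \<in> perp_closure S r Y \<Longrightarrow> (x, y) \<in> e \<Longrightarrow> y \<in> perp_closure S r Y"
  unfolding mem_perp_closure_iff e_iff by blast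

text \<open>The midpoint of a factorization stays in \<open>X\<close> because closed sets are
  downward closed under \<open>e\<close>.\<close>

lemma factor_in_closed:
  assumes "x \<in> X" "(x, z) \<in> r"
  obtains y where "y \<in> X" "(x, y) \<in> e" "(y, z) \<in> m"
proof -
  have "(x, z) \<in> Mult S (e, m)"
    using fs assms unfolding factorization_system_def by simp
  then obtain y where y: "(x, y) \<in> e" "(y, z) \<in> m"
    unfolding Mult_def by auto
  moreover have "y \<in> X"
    using perp_closure_e_down[of x X y] y assms perp_closure_eq[OF X] by simp
  ultimately show thesis using that by blast
qed

lemma r_maximal_imp_e:
  assumes "x \<in> X" "(x, c) \<in> r" "c \<in> maximal_elements m X"
  shows "(x, c) \<in> e"
  using factor_in_closed[OF assms(1,2)] assms(3) unfolding maximal_elements_def by blast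

lemma Cov_subset_maximal:
  assumes ac: "two_acyclic e m" and c: "c \<in> Cov S r e X"
  shows "c \<in> maximal_elements e (maximal_elements m X)"
proof -
  let ?D = "Del e X c"
  have cX: "c \<in> X" and D: "perp_closed S r ?D" and gen: "perp_closure S r (?D \<union> {c}) = X"
    using c unfolding Cov_def by auto
  have XS: "X \<subseteq> S" using X by (rule perp_closed_subset)
  have ant: "antisym e" "antisym m" and acyc: "\<And>x y. (x, y) \<in> e \<Longrightarrow> (y, x) \<in> m \<Longrightarrow> x = y"
    using ac unfolding two_acyclic_def by auto
  have "(c, c) \<in> e" using cX XS e_iff by blast
  then have "c \<notin> perp_closure S r ?D"
    using perp_closure_eq[OF D] unfolding Del_def by blast
  then obtain z where cz: "(c, z) \<in> r" and Dz: "\<And>d. d \<in> ?D \<Longrightarrow> (d, z) \<notin> r"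
    using cX XS unfolding mem_perp_closure_iff by blast
  \<comment> \<open>The midpoint \<open>y\<close> is related to \<open>z\<close>, so it is not in
    \<open>?D\<close>; this closes an \<open>e\<close>-cycle between \<open>c\<close> and
    \<open>y\<close>. The witness \<open>z\<close> can then be traded for \<open>c\<close>
    itself.\<close>
  have "(c, z) \<in> m"
  proof -
    obtain y where y: "y \<in> X" "(c, y) \<in> e" "(y, z) \<in> m"
      using factor_in_closed[OF cX cz] .
    have "(y, c) \<in> e"
      using Dz[of y] m_imp_r y unfolding Del_def by blast
    then have "y = c" using ant y by (auto dest: antisymD)
    then show ?thesis using y by simp
  qed
  then have Dc: "(d, c) \<notin> r" if "d \<in> ?D" for d
    using Dz[OF that] r_m_trans by blast
  have above: "\<exists>d \<in> ?D \<union> {c}. (d, c') \<in> r" if "c' \<in> X" for c'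
    using that gen r_refl XS mem_perp_closure_iff[of c' S r "?D \<union> {c}"] by blast
  have cC: "c \<in> maximal_elements m X"
  proof -
    have "c' = c" if c': "c' \<in> X" "(c', c) \<in> m" for c'
    proof -
      \<comment> \<open>Any \<open>d\<close> in \<open>?D\<close> related to \<open>c'\<close> would
        be related to \<open>c\<close>, so only \<open>c\<close> can reach
        \<open>c'\<close>.\<close>
      have "(c, c') \<in> r"
        using above[OF c'(1)] Dc r_m_trans[OF _ c'(2)] by blast
      then obtain y where y: "y \<in> X" "(c, y) \<in> e" "(y, c') \<in> m"
        using factor_in_closed[OF cX] by blast
      \<comment> \<open>Through \<open>c'\<close>, \<open>y\<close> lies above \<open>c\<close> in
        \<open>m\<close>, while \<open>c\<close> lies above \<open>y\<close> in \<open>e\<close>: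
        mixed acyclicity applies.\<close>
      then have "y = c"
        using acyc transD[OF trans_m] c' by blast
      then show ?thesis using ant y c' by (auto dest: antisymD)
    qed
    then show ?thesis using cX unfolding maximal_elements_def by blast
  qed
  have "c' = c" if c': "c' \<in> maximal_elements m X" "(c', c) \<in> e" for c'
  proof -
    have c'X: "c' \<in> X" using c' unfolding maximal_elements_def by simp
    then obtain d where d: "d \<in> ?D \<union> {c}" "(d, c') \<in> r"
      using above by blast
    then have "d \<in> X" using cX unfolding Del_def by blast
    \<comment> \<open>In \<open>e\<close>, \<open>d\<close> is above \<open>c'\<close> and hence
      above \<open>c\<close>. This rules out \<open>?D\<close>, so \<open>d = c\<close>, leaving an
      \<open>e\<close>-cycle of \<open>c\<close> and \<open>c'\<close>.\<close>
    then have "(d, c') \<in> e" using r_maximal_imp_e d c' by blast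
    moreover from this have "(d, c) \<in> e" using trans_e c' by (blast dest: transD)
    then have "d = c" using d unfolding Del_def by blast
    ultimately show ?thesis using ant c' by (auto dest: antisymD)
  qed
  then show ?thesis
    using cC unfolding maximal_elements_def[of e] by blast
qed

lemma maximal_in_Cov:
  assumes am: "antisym m" and "finite X"
    and c: "c \<in> maximal_elements e (maximal_elements m X)"
  shows "c \<in> Cov S r e X"
proof -
  let ?D = "Del e X c"
  have XS: "X \<subseteq> S" using X by (rule perp_closed_subset)
  have cC: "c \<in> maximal_elements m X" and cX: "c \<in> X"
    and cmax: "\<And>c'. c' \<in> maximal_elements m X \<Longrightarrow> (c', c) \<in> e \<Longrightarrow> c' = c"
    using c unfolding maximal_elements_def by auto
  have DX: "?D \<subseteq> X" unfolding Del_def by blast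
  have "c \<notin> perp_closure S r ?D"
  proof
    assume "c \<in> perp_closure S r ?D"
    then obtain d where "d \<in> ?D" "(d, c) \<in> r"
      using r_refl cX XS unfolding mem_perp_closure_iff by blast
    then show False
      using r_maximal_imp_e cC unfolding Del_def by blast
  qed
  \<comment> \<open>A point of \<open>X\<close> outside \<open>?D\<close> is above \<open>c\<close>
    in \<open>e\<close>, so its presence in the closure would bring \<open>c\<close> in.\<close>
  then have "perp_closure S r ?D \<subseteq> ?D"
    using perp_closure_e_down perp_closure_mono[OF DX, of S r] perp_closure_eq[OF X]
    unfolding Del_def by blast
  then have closed: "perp_closed S r ?D"
    using subset_perp_closure[of ?D S r] DX XS unfolding perp_closed_def by blast
  \<comment> \<open>Each relation from \<open>x\<close> to \<open>w\<close> is witnessed by an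
    \<open>m\<close>-maximal \<open>c'\<close> above the midpoint; by \<open>cmax\<close>,
    \<open>c'\<close> is \<open>c\<close> or survives the deletion.\<close>
  have "x \<in> perp_closure S r (?D \<union> {c})" if x: "x \<in> X" for x
    unfolding mem_perp_closure_iff
  proof (intro conjI ballI impI)
    show "x \<in> S" using x XS by blast
    fix w assume "(x, w) \<in> r"
    then obtain y where y: "y \<in> X" "(y, w) \<in> m" using factor_in_closed[OF x] by blast
    then have "(y, y) \<in> m" using XS m_iff by blast
    then obtain c' where c': "c' \<in> maximal_elements m X" "(c', y) \<in> m"
      using finite_maximal_above[OF \<open>finite X\<close> trans_m am] y by blast
    then have "(c', w) \<in> r" using y trans_m m_imp_r by (blast dest: transD)
    moreover have "c' \<in> ?D \<union> {c}"
      using c' cmax unfolding Del_def maximal_elements_def by blast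
    ultimately show "\<exists>d\<in>?D \<union> {c}. (d, w) \<in> r" by blast
  qed
  moreover have "perp_closure S r (?D \<union> {c}) \<subseteq> X"
    using perp_closure_mono[of "?D \<union> {c}" X S r] DX cX perp_closure_eq[OF X] by blast
  ultimately show ?thesis
    using closed cX unfolding Cov_def by blast
qed

end

theorem theorem5p4:
  fixes S X C :: "'a set" and r e m :: "'a rel"
  assumes "factorization_system S r e m"
    and "two_acyclic e m"
    and "perp_closed S r X"
    and "C = maximal_elements m X"
  shows "Cov S r e X \<subseteq> maximal_elements e C \<and>
    (finite S \<or> finite X \<longrightarrow> Cov S r e X = maximal_elements e C)"
proof (intro conjI impI)
  show sub: "Cov S r e X \<subseteq> maximal_elements e C"
    using Cov_subset_maximal[OF assms(1,3,2)] assms(4) by blast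
  assume "finite S \<or> finite X"
  then have "finite X"
    using perp_closed_subset[OF assms(3)] finite_subset by blast
  moreover have "antisym m" using assms(2) by (simp add: two_acyclic_def)
  ultimately show "Cov S r e X = maximal_elements e C"
    using sub maximal_in_Cov[OF assms(1,3)] assms(4) by blast
qed

end
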